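(* Let $d\ge2$, $n\ge 1$ and $\mathcal A\in\mathbb S^{n^d}$. Let $\mathcal X^*\in C$, $\mathcal Y^*\in\mathbb S^{n^d}$ and $\Lambda^*\in\mathbb R^{n^d}$ satisfy the optimality conditions $$\langle-\Lambda^*,\mathcal X-\mathcal X^*\rangle\ge 0\ \ \forall \mathcal X\in C,\qquad \langle-\mathcal A+\Lambda^*,\mathcal Y-\mathcal Y^*\rangle\ge 0\ \ \forall\mathcal Y\in\mathbb S^{n^d},\qquad \mathcal X^*=\mathcal Y^*.$$ Then: 1. $\mathrm{Sym}(\Lambda^* )=\mathcal A$; 2. $\mathcal X^*$ is an optimal (global) solution of problem (O).
   Context: All tensors are real. $\mathbb R^{n^d}$ is the space of $d$-th order $n$-dimensional tensors with entrywise inner product $\langle\cdot,\cdot\rangle$ and Frobenius norm $\|\cdot\|_F$; $\mathbb S^{n^d}$ is the subspace of symmetric tensors (entries invariant under all permutations of the indices). $\mathrm{Sym}(\mathcal B)$ is the average of $\mathcal B$ over all $d!$ permutations of its indices. $\mathrm{Mat}(\mathcal B)\in\mathbb R^{n^{\lfloor d/2\rfloor}\times n^{\lceil d/2\rceil}}$ is the reshaping of $\mathcal B$ with rows indexed by the first $\lfloor d/2\rfloor$ indices and columns by the remaining ones (both enumerated as in Matlab's reshape). The set $C\subset\mathbb R^{n^d}$: if $d$ is even, $C=\{\mathcal X\in\mathbb R^{n^d}\mid \operatorname{rank}(\mathrm{Mat}(\mathcal X))=1,\ \mathrm{Mat}(\mathcal X)\text{ symmetric},\ \operatorname{tr}(\mathrm{Mat}(\mathcal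 X))=1\}$; if $d$ is odd, $C=\{\mathcal X\in\mathbb R^{n^d}\mid\operatorname{rank}(\mathrm{Mat}(\mathcal X))=1,\ \|\mathcal X\|_F=1\}$. Problem (O): maximize $\langle\mathcal A,\mathcal X\rangle$ subject to $\operatorname{rank}(\mathrm{Mat}(\mathcal X))=1$, $\mathcal X\in\mathbb S^{n^d}$, and $\operatorname{tr}(\mathrm{Mat}(\mathcal X))=1$ if $d$ is even, $\|\mathcal X\|_F=1$ if $d$ is odd. *)

theory Defs
  imports
    Complex_Main
    "HOL-Library.Function_Algebras"
    "HOL-Combinatorics.Permutations"
    "Jordan_Normal_Form.DL_Rank"
begin

text \<open>Indices are zero-based throughout: a multi-index of a tensor of order \<open>d\<close> and dimension \<open>n\<close>
  is a list of length \<open>d\<close> with entries below \<open>n\<close>.\<close>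

type_synonym tensor = "nat list \<Rightarrow> real"

definition multi_indices :: "nat \<Rightarrow> nat \<Rightarrow> nat list set" where
  "multi_indices n d = {ix. length ix = d \<and> set ix \<subseteq> {..<n}}"

text \<open>Tensors vanish outside their index set, so that HOL equality of tensors is entrywise equality
  and the pointwise operations on functions are the vector space operations.\<close>

definition tensor_space :: "nat \<Rightarrow> nat \<Rightarrow> tensor set" where
  "tensor_space n d = {X. \<forall>ix. ix \<notin> multi_indices n d \<longrightarrow> X ix = 0}"

definition tensor_inner :: "nat \<Rightarrow> nat \<Rightarrow> tensor \<Rightarrow> tensor \<Rightarrow> real" where
  "tensor_inner n d X Y = (\<Sum>ix\<in>multi_indices n d. X ix * Y ix)"

definition frobenius_norm :: "nat \<Rightarrow> nat \<Rightarrow> tensor \<Rightarrow> real" where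
  "frobenius_norm n d X = sqrt (tensor_inner n d X X)"

definition sym_tensors :: "nat \<Rightarrow> nat \<Rightarrow> tensor set" where
  "sym_tensors n d = {X \<in> tensor_space n d.
     \<forall>p ix. p permutes {..<d} \<longrightarrow> ix \<in> multi_indices n d \<longrightarrow> X (permute_list p ix) = X ix}"

definition Sym :: "nat \<Rightarrow> tensor \<Rightarrow> tensor" where
  "Sym d B = (\<lambda>ix. (\<Sum>p | p permutes {..<d}. B (permute_list p ix)) / fact d)"

text \<open>The multi-index of order \<open>m\<close> at position \<open>r < n ^ m\<close> of Matlab's column-major enumeration,
  in which the first index varies fastest.\<close>

definition unrank_index :: "nat \<Rightarrow> nat \<Rightarrow> nat \<Rightarrow> nat list" where
  "unrank_index n m r = map (\<lambda>k. (r div n ^ k) mod n) [0..<m]"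

definition Mat :: "nat \<Rightarrow> nat \<Rightarrow> tensor \<Rightarrow> real mat" where
  "Mat n d B = mat (n ^ (d div 2)) (n ^ (d - d div 2))
     (\<lambda>(r, c). B (unrank_index n (d div 2) r @ unrank_index n (d - d div 2) c))"

definition mat_rank :: "real mat \<Rightarrow> nat" where
  "mat_rank M = vec_space.rank (dim_row M) M"

definition mat_trace :: "real mat \<Rightarrow> real" where
  "mat_trace M = (\<Sum>i<dim_row M. M $$ (i, i))"

definition mat_symmetric :: "real mat \<Rightarrow> bool" where
  "mat_symmetric M \<longleftrightarrow> transpose_mat M = M"

definition C_set :: "nat \<Rightarrow> nat \<Rightarrow> tensor set" where
  "C_set n d =
     (if even d
      then {X \<in> tensor_space n d. mat_rank (Mat n d X) = 1 \<and> mat_symmetric (Mat n d X) \<and>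
              mat_trace (Mat n d X) = 1}
      else {X \<in> tensor_space n d. mat_rank (Mat n d X) = 1 \<and> frobenius_norm n d X = 1})"

definition feasible_O :: "nat \<Rightarrow> nat \<Rightarrow> tensor set" where
  "feasible_O n d = {X \<in> sym_tensors n d. mat_rank (Mat n d X) = 1 \<and>
     (if even d then mat_trace (Mat n d X) = 1 else frobenius_norm n d X = 1)}"

definition optimal_O :: "nat \<Rightarrow> nat \<Rightarrow> tensor \<Rightarrow> tensor \<Rightarrow> bool" where
  "optimal_O n d A X \<longleftrightarrow> X \<in> feasible_O n d \<and>
     (\<forall>Z\<in>feasible_O n d. tensor_inner n d A Z \<le> tensor_inner n d A X)"

end

theory Submission
  imports Defs
begin

text \<open>The condition on \<open>Y\<close> ranges over a linear subspace, so it makes \<open>L - A\<close> orthogonal to all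
  symmetric tensors. As \<open>Sym\<close> is the orthogonal projection onto them, \<open>Sym d L - A\<close> is orthogonal
  to itself. Moreover \<open>L\<close> and \<open>A\<close> define the same linear functional on the feasible set of (O), which
  is contained in \<open>C\<close>, and over \<open>C\<close> the functional of \<open>L\<close> is maximal at \<open>Xs\<close>.\<close>

lemma finite_multi_indices: "finite (multi_indices n d)"
  unfolding multi_indices_def using finite_lists_length_eq[of "{..<n}" d] by (simp add: conj_commute)

lemma length_multi_indices: "ix \<in> multi_indices n d \<Longrightarrow> length ix = d"
  by (simp add: multi_indices_def)

lemma permute_list_in_multi_indices_iff:
  assumes "p permutes {..<d}"
  shows "permute_list p ix \<in> multi_indices n d \<longleftrightarrow> ix \<in> multi_indices n d"
  using assms by (auto simp: multi_indices_def)

lemma bij_betw_permute_list_multi_indices: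
  assumes p: "p permutes {..<d}"
  shows "bij_betw (permute_list p) (multi_indices n d) (multi_indices n d)"
proof (rule bij_betw_byWitness[where f' = "permute_list (inv_into UNIV p)"])
  have q: "inv_into UNIV p permutes {..<d}" using p by (rule permutes_inv)
  show "\<forall>ix\<in>multi_indices n d. permute_list (inv_into UNIV p) (permute_list p ix) = ix"
    using permute_list_compose[of "inv_into UNIV p" _ p] q p
    by (metis length_multi_indices permutes_inv_o(1) permute_list_id)
  show "\<forall>ix\<in>multi_indices n d. permute_list p (permute_list (inv_into UNIV p) ix) = ix"
    using permute_list_compose[of p _ "inv_into UNIV p"] q p
    by (metis length_multi_indices permutes_inv_o(2) permute_list_id)
qed (use permute_list_in_multi_indices_iff p permutes_inv[OF p] in blast)+

lemma sym_tensors_add: "X \<in> sym_tensors n d \<Longrightarrow> Y \<in> sym_tensors n d \<Longrightarrow> X + Y \<in> sym_tensors n d"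
  by (simp add: sym_tensors_def tensor_space_def)

lemma sym_tensors_diff: "X \<in> sym_tensors n d \<Longrightarrow> Y \<in> sym_tensors n d \<Longrightarrow> X - Y \<in> sym_tensors n d"
  by (simp add: sym_tensors_def tensor_space_def)

lemma tensor_inner_diff_left:
  "tensor_inner n d (X - Y) Z = tensor_inner n d X Z - tensor_inner n d Y Z"
  by (simp add: tensor_inner_def left_diff_distrib sum_subtractf)

lemma tensor_inner_add_left:
  "tensor_inner n d (X + Y) Z = tensor_inner n d X Z + tensor_inner n d Y Z"
  by (simp add: tensor_inner_def distrib_right sum.distrib)

lemma tensor_inner_minus_left: "tensor_inner n d (- X) Z = - tensor_inner n d X Z"
  by (simp add: tensor_inner_def sum_negf)

lemma tensor_inner_diff_right:
  "tensor_inner n d X (Y - Z) = tensor_inner n d X Y - tensor_inner n d X Z"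
  by (simp add: tensor_inner_def right_diff_distrib sum_subtractf)

text \<open>A vanishing sum of squares forces every entry on the index set to vanish. The remaining
  entries are zero by membership in \<open>tensor_space\<close>, which is what gives equality as
  functions.\<close>

lemma tensor_inner_self_eq_0D:
  assumes "X \<in> tensor_space n d" "tensor_inner n d X X = 0"
  shows "X = 0"
proof
  fix ix
  show "X ix = 0 ix"
    using assms by (cases "ix \<in> multi_indices n d")
      (auto simp: tensor_inner_def tensor_space_def finite_multi_indices sum_nonneg_eq_0_iff)
qed

text \<open>Permuting the argument by \<open>q\<close> replaces each \<open>p\<close> in the average
  by \<open>q \<circ> p\<close>, and left translation by \<open>q\<close> only reorders the
  symmetric group.\<close>

lemma Sym_in_sym_tensors:
  assumes "B \<in> tensor_space n d"
  shows "Sym d B \<in> sym_tensors n d"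
proof -
  have "Sym d B \<in> tensor_space n d"
    using assms by (simp add: Sym_def tensor_space_def permute_list_in_multi_indices_iff)
  moreover have "Sym d B (permute_list q ix) = Sym d B ix"
    if q: "q permutes {..<d}" and ix: "ix \<in> multi_indices n d" for q ix
  proof -
    have "(\<Sum>p | p permutes {..<d}. B (permute_list p (permute_list q ix)))
        = (\<Sum>p | p permutes {..<d}. B (permute_list (q \<circ> p) ix))"
      using ix by (intro sum.cong) (auto simp: permute_list_compose length_multi_indices)
    also have "\<dots> = (\<Sum>p | p permutes {..<d}. B (permute_list p ix))"
      using setum_permutations_compose_left[OF q, of "\<lambda>p. B (permute_list p ix)"] by simp
    finally show ?thesis by (simp add: Sym_def)
  qed
  ultimately show ?thesis by (simp add: sym_tensors_def)
qed

text \<open>Since \<open>W\<close> is symmetric, the permutation on \<open>B\<close> can be put on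
  \<open>W\<close> too and then removed by reindexing. All \<open>d!\<close> terms of the average
  thus contribute the same inner product.\<close>

lemma tensor_inner_Sym_left:
  assumes W: "W \<in> sym_tensors n d"
  shows "tensor_inner n d (Sym d B) W = tensor_inner n d B W"
proof -
  have "(\<Sum>ix\<in>multi_indices n d. B (permute_list p ix) * W ix) = tensor_inner n d B W"
    if p: "p permutes {..<d}" for p
  proof -
    have "(\<Sum>ix\<in>multi_indices n d. B (permute_list p ix) * W ix)
        = (\<Sum>ix\<in>multi_indices n d. B (permute_list p ix) * W (permute_list p ix))"
      using W p by (intro sum.cong) (auto simp: sym_tensors_def)
    also have "\<dots> = tensor_inner n d B W"
      unfolding tensor_inner_def
      by (rule sum.reindex_bij_betw[OF bij_betw_permute_list_multi_indices[OF p]])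
    finally show ?thesis .
  qed
  moreover have "tensor_inner n d (Sym d B) W
      = (\<Sum>p | p permutes {..<d}. \<Sum>ix\<in>multi_indices n d. B (permute_list p ix) * W ix) / fact d"
    unfolding tensor_inner_def Sym_def
    by (subst sum.swap) (simp add: sum_divide_distrib sum_distrib_right)
  ultimately show ?thesis by (simp add: card_permutations[OF refl])
qed

lemma unrank_index_in_multi_indices: "n \<ge> 1 \<Longrightarrow> unrank_index n m r \<in> multi_indices n m"
  by (auto simp: unrank_index_def multi_indices_def)

lemma sym_tensors_append_commute:
  assumes "X \<in> sym_tensors n (k + l)" "u \<in> multi_indices n k" "v \<in> multi_indices n l"
  shows "X (u @ v) = X (v @ u)"
proof -
  \<comment> \<open>The two concatenations have the same multiset of entries, so no explicit
    block-swapping permutation is needed.\<close>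
  obtain p where "p permutes {..<length (v @ u)}" "permute_list p (v @ u) = u @ v"
    using mset_eq_permutation[of "u @ v" "v @ u"] by (auto simp: add.commute)
  moreover have "length (v @ u) = k + l" "v @ u \<in> multi_indices n (k + l)"
    using assms(2,3) by (auto simp: multi_indices_def)
  ultimately show ?thesis
    using assms(1) by (simp add: sym_tensors_def) metis
qed

text \<open>For even \<open>d\<close>, row and column multi-indices have equal length, and
  transposition swaps the two halves of the full multi-index. With \<open>n \<ge> 1\<close> every
  digit taken \<open>mod n\<close> is below \<open>n\<close>, so the halves are genuine
  multi-indices.\<close>

lemma mat_symmetric_Mat:
  assumes "X \<in> sym_tensors n d" "even d" "n \<ge> 1"
  shows "mat_symmetric (Mat n d X)"
proof -
  have "d - d div 2 = d div 2" "d div 2 + d div 2 = d" using \<open>even d\<close> by auto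
  then show ?thesis
    using assms sym_tensors_append_commute[of X n "d div 2" "d div 2"]
    by (auto simp: mat_symmetric_def Mat_def unrank_index_in_multi_indices intro!: eq_matI)
qed

lemma feasible_O_subset_C_set: "n \<ge> 1 \<Longrightarrow> feasible_O n d \<subseteq> C_set n d"
  by (auto simp: feasible_O_def C_set_def mat_symmetric_Mat) (auto simp: sym_tensors_def)

theorem theorem3p1:
  fixes n d :: nat and A Xs Ys L :: tensor
  assumes "d \<ge> 2" and "n \<ge> 1"
    and "A \<in> sym_tensors n d"
    and "Xs \<in> C_set n d" and "Ys \<in> sym_tensors n d" and "L \<in> tensor_space n d"
    and "\<forall>X\<in>C_set n d. tensor_inner n d (- L) (X - Xs) \<ge> 0"
    and "\<forall>Y\<in>sym_tensors n d. tensor_inner n d (- A + L) (Y - Ys) \<ge> 0"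
    and "Xs = Ys"
  shows "Sym d L = A \<and> optimal_O n d A Xs"
proof
  have functional_eq: "tensor_inner n d L W = tensor_inner n d A W"
    if W: "W \<in> sym_tensors n d" for W
  \<comment> \<open>The test points \<open>Ys + W\<close> and \<open>Ys - W\<close> are both
    symmetric and yield the two opposite inequalities.\<close>
  proof (rule antisym)
    show "tensor_inner n d A W \<le> tensor_inner n d L W"
      using bspec[OF assms(8) sym_tensors_add[OF assms(5) W]]
      by (simp add: tensor_inner_diff_left)
    have "tensor_inner n d (- A + L) ((Ys - W) - Ys) \<ge> 0"
      using assms(8) sym_tensors_diff[OF assms(5) W] by blast
    then show "tensor_inner n d L W \<le> tensor_inner n d A W"
      unfolding tensor_inner_add_left tensor_inner_minus_left tensor_inner_diff_right by linarith
  qed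
  have D: "Sym d L - A \<in> sym_tensors n d"
    by (intro sym_tensors_diff Sym_in_sym_tensors assms)
  \<comment> \<open>Symmetry of the right argument allows \<open>Sym d L\<close> to be replaced by
    \<open>L\<close>, and then \<open>L\<close> by \<open>A\<close>.\<close>
  then have "tensor_inner n d (Sym d L - A) (Sym d L - A) = 0"
    by (simp add: tensor_inner_diff_left[of n d "Sym d L" A] tensor_inner_Sym_left functional_eq)
  then have "Sym d L - A = 0"
    using D by (intro tensor_inner_self_eq_0D) (auto simp: sym_tensors_def)
  then show "Sym d L = A" by simp
  \<comment> \<open>\<open>C\<close> supplies the rank and normalization constraints, and the
    equality with \<open>Ys\<close> supplies symmetry of the tensor.\<close>
  have "Xs \<in> feasible_O n d"
    using assms(4,5,9) by (auto simp: feasible_O_def C_set_def split: if_splits)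
  moreover have "tensor_inner n d A Z \<le> tensor_inner n d A Xs" if Z: "Z \<in> feasible_O n d" for Z
  proof -
    have "tensor_inner n d L Z \<le> tensor_inner n d L Xs"
      using bspec[OF assms(7), of Z] Z feasible_O_subset_C_set[OF assms(2)]
      by (auto simp: tensor_inner_minus_left tensor_inner_diff_right)
    \<comment> \<open>Both \<open>Z\<close> and \<open>Xs\<close> are symmetric, so \<open>L\<close>
      may be exchanged for \<open>A\<close> on each side.\<close>
    then show ?thesis
      using Z assms(5,9) functional_eq by (simp add: feasible_O_def)
  qed
  ultimately show "optimal_O n d A Xs" by (simp add: optimal_O_def)
qed

end
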